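(* Let $k \geqslant 2$ and $n \geqslant 30$ be integers with $$k \leqslant \sqrt{\frac{n}{\ln n}}.$$ Then $$m^*_k(n) \geqslant \frac{25}{18e^{52}}\cdot\frac{2^{2(n-1)}}{k(n-1)\ln (n-1)\binom{n-2}{k-1}^2}.$$
   Context: A hypergraph is a pair $H=(V,E)$ with $V$ a finite vertex set and $E$ a family of subsets of $V$; it is $n$-uniform if every edge has exactly $n$ vertices. It is simple if any two distinct edges have at most one common vertex. A hypergraph has property $B_k$ if there is a 2-coloring of its vertices such that every edge contains at least $k$ vertices of each color. $m^*_k(n)$ denotes the minimum number of edges of a simple $n$-uniform hypergraph that does not have property $B_k$. *)

theory Defs
  imports Complex_Main "HOL-Library.Extended_Nat" "HOL-Library.Extended_Real"
begin

type_synonym 'a hgraph = "'a set \<times> 'a set set"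

definition hypergraph :: "'a hgraph \<Rightarrow> bool" where
  "hypergraph H \<longleftrightarrow> (case H of (V, E) \<Rightarrow> finite V \<and> E \<subseteq> Pow V)"

definition uniform :: "nat \<Rightarrow> 'a hgraph \<Rightarrow> bool" where
  "uniform n H \<longleftrightarrow> (case H of (V, E) \<Rightarrow> \<forall>e\<in>E. card e = n)"

definition simple :: "'a hgraph \<Rightarrow> bool" where
  "simple H \<longleftrightarrow> (case H of (V, E) \<Rightarrow> \<forall>e\<in>E. \<forall>f\<in>E. e \<noteq> f \<longrightarrow> card (e \<inter> f) \<le> 1)"

definition property_B :: "nat \<Rightarrow> 'a hgraph \<Rightarrow> bool" where
  "property_B k H \<longleftrightarrow> (case H of (V, E) \<Rightarrow>
     \<exists>c :: 'a \<Rightarrow> bool. \<forall>e\<in>E. \<forall>b. k \<le> card {v\<in>e. c v = b})"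

(* Every finite hypergraph is isomorphic to one on natural numbers, so the
   vertices are taken from nat without loss of generality.  The infimum of a
   nonempty set in enat is its minimum; the infimum of the empty set is infinity. *)
definition m_star :: "nat \<Rightarrow> nat \<Rightarrow> enat" where
  "m_star k n = Inf {enat (card E) | (V :: nat set) E.
     hypergraph (V, E) \<and> uniform n (V, E) \<and> simple (V, E) \<and> \<not> property_B k (V, E)}"

end

theory Submission
  imports Defs "HOL-Probability.Probability"
begin

text \<open>
  Put \<open>N = n - 1\<close> and \<open>b = (N - 1) choose (k - 1)\<close>. A simple \<open>N\<close>-uniform hypergraph whose vertex
  degrees are at most \<open>\<delta> = c 2^N / (b sqrt (N ln N))\<close> has property \<open>B\<^sub>k\<close>. Indeed, colour greedily in a
  random order given by independent uniform weights. The colouring fails only if two edges meet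
  in a vertex that is among the last \<open>k\<close> vertices of one and the first \<open>k\<close> vertices of the other. With
  a weight in a window of relative length \<open>ln N / N\<close> around the median this has probability
  \<open>O(b\<^sup>2 4^(-N) ln N / N)\<close>; otherwise nearly all weights of one edge lie on one side of the window,
  which has probability \<open>O(b 2^(-N) / N)\<close>. The local lemma excludes all these events.

  For a simple \<open>n\<close>-uniform hypergraph without \<open>B\<^sub>k\<close>, deleting from each edge a vertex of maximal
  degree leaves a hypergraph without \<open>B\<^sub>k\<close>, hence with a vertex of degree more than \<open>\<delta>\<close>. The vertices
  deleted from the edges at this vertex are distinct and also have degree more than \<open>\<delta>\<close>, which
  yields at least \<open>\<delta>\<^sup>2 / 2\<close> edges.
\<close>

section \<open>The local lemma and independent weights\<close>

text \<open>By induction on \<open>S\<close>, avoiding the events of \<open>S\<close> at most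
  doubles the probability of any \<open>B i\<close>. The bound is kept in product form, so nothing
  is conditioned on an event not yet known to have positive probability. Avoiding further events one
  at a time then never reaches probability 0.\<close>

lemma (in prob_space) local_lemma:
  fixes B :: "'i \<Rightarrow> 'a set" and dep :: "'i \<Rightarrow> 'i \<Rightarrow> bool"
  assumes "finite I" and events: "\<And>i. i \<in> I \<Longrightarrow> B i \<in> events"
    and refl: "\<And>i. i \<in> I \<Longrightarrow> dep i i"
    and indep: "\<And>i S. i \<in> I \<Longrightarrow> S \<subseteq> I \<Longrightarrow> (\<And>j. j \<in> S \<Longrightarrow> \<not> dep i j) \<Longrightarrow>
      prob (B i \<inter> (space M - \<Union>(B ` S))) = prob (B i) * prob (space M - \<Union>(B ` S))"
    and small: "\<And>i. i \<in> I \<Longrightarrow> (\<Sum>j\<in>{j\<in>I. dep i j}. prob (B j)) \<le> 1 / 4"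
  shows "prob (space M - \<Union>(B ` I)) > 0"
proof -
  define avoid where "avoid S = space M - \<Union>(B ` S)" for S
  have fin: "finite S" if "S \<subseteq> I" for S
    using that \<open>finite I\<close> finite_subset by blast
  have av: "avoid S \<in> events" if "S \<subseteq> I" for S
    unfolding avoid_def using that fin[OF that] events by (intro sets.Diff sets.finite_UN) auto
  have split: "prob (avoid T) \<le> prob (avoid (T \<union> S)) + (\<Sum>j\<in>S. prob (B j \<inter> avoid T))"
    if "T \<subseteq> I" "S \<subseteq> I" for S T
  proof -
    have "avoid T \<subseteq> avoid (T \<union> S) \<union> (\<Union>j\<in>S. B j \<inter> avoid T)"
      by (auto simp: avoid_def)
    then have "prob (avoid T) \<le> prob (avoid (T \<union> S) \<union> (\<Union>j\<in>S. B j \<inter> avoid T))"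
      using that fin events av by (intro finite_measure_mono sets.Un sets.finite_UN) auto
    also have "\<dots> \<le> prob (avoid (T \<union> S)) + prob (\<Union>j\<in>S. B j \<inter> avoid T)"
      using that fin events av by (intro measure_Un_le sets.finite_UN) auto
    also have "prob (\<Union>j\<in>S. B j \<inter> avoid T) \<le> (\<Sum>j\<in>S. prob (B j \<inter> avoid T))"
      using that fin events av by (intro finite_measure_subadditive_finite) auto
    finally show ?thesis by simp
  qed
  have le: "prob (B i) \<le> 1 / 4" if "i \<in> I" for i
  proof -
    have "prob (B i) \<le> (\<Sum>j\<in>{j\<in>I. dep i j}. prob (B j))"
      using that refl \<open>finite I\<close> by (intro member_le_sum) auto
    with small[OF that] show ?thesis by simp
  qed
  have cond: "prob (B i \<inter> avoid S) \<le> 2 * prob (B i) * prob (avoid S)" if "S \<subseteq> I" "i \<in> I" for S i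
    using fin[OF \<open>S \<subseteq> I\<close>] that
  proof (induction S arbitrary: i rule: finite_psubset_induct)
    case (psubset S)
    define S1 where "S1 = {j\<in>S. dep i j}"
    define S2 where "S2 = S - S1"
    have sub: "S1 \<subseteq> I" "S2 \<subseteq> I" and un: "S2 \<union> S1 = S"
      using psubset.prems by (auto simp: S1_def S2_def)
    \<comment> \<open>Neighbours of \<open>i\<close> are separated from the rest. Given
      \<open>avoid S2\<close>, the induction hypothesis bounds the total probability of the
      neighbours by 2 * 1/4, so passing from \<open>S2\<close> to \<open>S\<close> keeps at least
      half of the mass. This is the factor 2 in the claim.\<close>
    have "(\<Sum>j\<in>S1. prob (B j \<inter> avoid S2)) \<le> (\<Sum>j\<in>S1. 2 * prob (B j) * prob (avoid S2))"
    proof (rule sum_mono)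
      fix j assume j: "j \<in> S1"
      then have "S2 \<subset> S"
        by (auto simp: S1_def S2_def)
      with j sub show "prob (B j \<inter> avoid S2) \<le> 2 * prob (B j) * prob (avoid S2)"
        by (intro psubset.IH) auto
    qed
    also have "\<dots> = 2 * (\<Sum>j\<in>S1. prob (B j)) * prob (avoid S2)"
      by (simp add: sum_distrib_left sum_distrib_right)
    also have "(\<Sum>j\<in>S1. prob (B j)) \<le> (\<Sum>j\<in>{j\<in>I. dep i j}. prob (B j))"
      using psubset.prems \<open>finite I\<close> by (intro sum_mono2) (auto simp: S1_def)
    also have "\<dots> \<le> 1 / 4"
      using small psubset.prems by blast
    finally have "(\<Sum>j\<in>S1. prob (B j \<inter> avoid S2)) \<le> prob (avoid S2) / 2"
      by (simp add: mult_right_mono)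
    with split[OF sub(2) sub(1)] have half: "prob (avoid S2) \<le> 2 * prob (avoid S)"
      unfolding un by linarith
    have "prob (B i \<inter> avoid S) \<le> prob (B i \<inter> avoid S2)"
      using psubset.prems sub events av
      by (intro finite_measure_mono) (auto simp: avoid_def S2_def)
    also have "\<dots> = prob (B i) * prob (avoid S2)"
      unfolding avoid_def using psubset.prems sub by (intro indep) (auto simp: S1_def S2_def)
    also have "\<dots> \<le> prob (B i) * (2 * prob (avoid S))"
      using half by (intro mult_left_mono) auto
    finally show ?case by simp
  qed
  have "prob (avoid S) > 0" if "S \<subseteq> I" for S
    using fin[OF that] that
  proof (induction S rule: finite_induct)
    case empty
    then show ?case by (simp add: avoid_def prob_space)
  next
    case (insert i S)
    have "prob (avoid S) \<le> prob (avoid (insert i S)) + prob (B i \<inter> avoid S)"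
      using split[of S "{i}"] insert.prems by simp
    also have "prob (B i \<inter> avoid S) \<le> 2 * prob (B i) * prob (avoid S)"
      using cond insert.prems by simp
    also have "\<dots> \<le> 2 * (1 / 4) * prob (avoid S)"
      using le insert.prems by (intro mult_mono) auto
    finally show ?case
      using insert by auto
  qed
  then show ?thesis
    unfolding avoid_def by blast
qed

section \<open>Events determined by few coordinates of independent discrete weights\<close>

definition determined_by :: "('a \<Rightarrow> 'b) set \<Rightarrow> 'a set \<Rightarrow> bool" where
  "determined_by A X \<longleftrightarrow> (\<forall>w w'. (\<forall>x\<in>X. w x = w' x) \<longrightarrow> w \<in> A \<longrightarrow> w' \<in> A)"

lemma determined_by_iff:
  "determined_by A X \<Longrightarrow> (\<And>x. x \<in> X \<Longrightarrow> w x = w' x) \<Longrightarrow> w \<in> A \<longleftrightarrow> w' \<in> A"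
  unfolding determined_by_def by metis

lemma determined_by_Int: "determined_by A X \<Longrightarrow> determined_by B Y \<Longrightarrow> determined_by (A \<inter> B) (X \<union> Y)"
  unfolding determined_by_def by (metis Int_iff UnCI)

lemma determined_by_Compl_UN:
  "(\<And>i. i \<in> I \<Longrightarrow> determined_by (B i) (X i)) \<Longrightarrow> determined_by (- \<Union>(B ` I)) (\<Union>(X ` I))"
  unfolding determined_by_def by (auto; metis)

lemma determined_by_card:
  "determined_by {w. card {u\<in>X. P (w u)} < k} X"
proof -
  have "{u\<in>X. P (w u)} = {u\<in>X. P (w' u)}" if "\<forall>x\<in>X. w x = w' x" for w w' :: "'a \<Rightarrow> 'b"
    using that by auto
  then show ?thesis
    unfolding determined_by_def by force
qed

text \<open>Both factors may be cut down to the supports, which are countable and carry all the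
  mass.\<close>

lemma prob_pair_pmf_Times:
  "measure_pmf.prob (pair_pmf M N) (A \<times> B) = measure_pmf.prob M A * measure_pmf.prob N B"
proof -
  have "measure_pmf.prob (pair_pmf M N) (A \<times> B) =
      measure_pmf.prob (pair_pmf M N) ((A \<inter> set_pmf M) \<times> (B \<inter> set_pmf N))"
    by (intro measure_prob_cong_0) (auto simp: set_pmf_iff pmf_pair)
  also have "\<dots> = measure_pmf.prob M (A \<inter> set_pmf M) * measure_pmf.prob N (B \<inter> set_pmf N)"
    by (intro measure_pmf_prob_product) (auto intro: countable_subset[OF Int_lower2])
  finally show ?thesis
    by (simp add: measure_Int_set_pmf)
qed

text \<open>A sample on \<open>V\<close> is glued from independent samples on \<open>X\<close> and
  on \<open>V - X\<close>; \<open>A\<close> sees only the first and \<open>B\<close> only the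
  second. Under a pmf every set is measurable, so being determined by disjoint coordinates suffices
  for independence.\<close>

lemma prob_Pi_pmf_Int:
  assumes "finite V" "X \<subseteq> V" "X \<inter> Y = {}"
    and A: "determined_by A X" and B: "determined_by B Y"
  shows "measure_pmf.prob (Pi_pmf V d p) (A \<inter> B) =
    measure_pmf.prob (Pi_pmf V d p) A * measure_pmf.prob (Pi_pmf V d p) B"
proof -
  define h :: "('a \<Rightarrow> 'b) \<times> ('a \<Rightarrow> 'b) \<Rightarrow> 'a \<Rightarrow> 'b"
    where "h = (\<lambda>(f, g) x. if x \<in> X then f x else g x)"
  let ?Q = "pair_pmf (Pi_pmf X d p) (Pi_pmf (V - X) d p)"
  have "Pi_pmf (X \<union> (V - X)) d p = map_pmf h ?Q"
    unfolding h_def using assms(1,2) by (intro Pi_pmf_union) (auto intro: finite_subset)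
  moreover have "X \<union> (V - X) = V"
    using assms(2) by auto
  ultimately have V: "Pi_pmf V d p = map_pmf h ?Q"
    by simp
  have hA: "h (f, g) \<in> A \<longleftrightarrow> f \<in> A" for f g
    by (rule determined_by_iff[OF A]) (simp add: h_def)
  have hB: "h (f, g) \<in> B \<longleftrightarrow> g \<in> B" for f g
    by (rule determined_by_iff[OF B]) (use assms(3) in \<open>auto simp: h_def\<close>)
  have "h -` (A \<inter> B) = A \<times> B" "h -` A = A \<times> UNIV" "h -` B = UNIV \<times> B"
    using hA hB by auto
  then show ?thesis
    unfolding V measure_map_pmf by (simp add: prob_pair_pmf_Times)
qed

lemma prob_Pi_pmf_component:
  assumes "finite V" "v \<in> V"
  shows "measure_pmf.prob (Pi_pmf V d p) {w. w v = t} = pmf (p v) t"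
proof -
  have "measure_pmf.prob (map_pmf (\<lambda>w. w v) (Pi_pmf V d p)) {t} = pmf (p v) t"
    using assms by (simp add: Pi_pmf_component pmf.rep_eq[symmetric] measure_pmf_single)
  then show ?thesis
    by (simp add: vimage_def)
qed

lemma map_pmf_mem_eq_bernoulli:
  "map_pmf (\<lambda>x. x \<in> Z) p = bernoulli_pmf (measure_pmf.prob p Z)"
proof (rule pmf_eqI)
  fix b
  show "pmf (map_pmf (\<lambda>x. x \<in> Z) p) b = pmf (bernoulli_pmf (measure_pmf.prob p Z)) b"
  proof (cases b)
    case True
    then show ?thesis
      by (simp add: pmf_map vimage_def)
  next
    case False
    have "measure_pmf.prob p (- Z) = 1 - measure_pmf.prob p Z"
      using measure_pmf.prob_compl[of Z p] by (simp add: Compl_eq_Diff_UNIV)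
    with False show ?thesis
      by (simp add: pmf_map vimage_def Compl_eq)
  qed
qed

text \<open>The indicators of \<open>w u \<in> Z\<close> are independent Bernoulli variables, hence
  their number of successes in \<open>X\<close> is binomial.\<close>

lemma prob_Pi_pmf_card_less:
  assumes "finite V" "X \<subseteq> V"
  shows "measure_pmf.prob (Pi_pmf V d (\<lambda>_. p)) {w. card {u\<in>X. w u \<in> Z} < k} =
    (\<Sum>i<k. (card X choose i) * measure_pmf.prob p Z ^ i * (1 - measure_pmf.prob p Z) ^ (card X - i))"
proof -
  let ?z = "measure_pmf.prob p Z"
  have "finite X"
    using assms finite_subset by blast
  have "binomial_pmf (card X) ?z =
      map_pmf (\<lambda>f. card {x\<in>X. f x}) (Pi_pmf X (d \<in> Z) (\<lambda>_. bernoulli_pmf ?z))"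
    using \<open>finite X\<close> by (intro binomial_pmf_altdef') auto
  also have "Pi_pmf X (d \<in> Z) (\<lambda>_. bernoulli_pmf ?z) =
      map_pmf (\<lambda>h. (\<lambda>x. x \<in> Z) \<circ> h) (Pi_pmf X d (\<lambda>_. p))"
    unfolding map_pmf_mem_eq_bernoulli[symmetric] using \<open>finite X\<close> by (intro Pi_pmf_map) auto
  also have "Pi_pmf X d (\<lambda>_. p) =
      map_pmf (\<lambda>f x. if x \<in> X then f x else d) (Pi_pmf V d (\<lambda>_. p))"
    using assms by (rule Pi_pmf_subset)
  also have "map_pmf (\<lambda>f. card {x\<in>X. f x}) (map_pmf (\<lambda>h. (\<lambda>x. x \<in> Z) \<circ> h) \<dots>) =
      map_pmf (\<lambda>w. card {u\<in>X. w u \<in> Z}) (Pi_pmf V d (\<lambda>_. p))"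
    unfolding map_pmf_comp by (intro map_pmf_cong arg_cong[of _ _ card]) auto
  finally have "measure_pmf.prob (binomial_pmf (card X) ?z) {..<k} =
      measure_pmf.prob (Pi_pmf V d (\<lambda>_. p)) {w. card {u\<in>X. w u \<in> Z} < k}"
    by (simp add: vimage_def)
  moreover have "measure_pmf.prob (binomial_pmf (card X) ?z) {..<k} =
      (\<Sum>i<k. pmf (binomial_pmf (card X) ?z) i)"
    by (intro measure_measure_pmf_finite) auto
  ultimately show ?thesis
    by simp
qed

section \<open>Greedy colouring\<close>

text \<open>The vertices are coloured greedily in the order of \<open>g\<close>: a vertex receives colour \<open>True\<close>
  unless some edge would then contain more than \<open>n - k\<close> of them. The first vertex of colour
  \<open>False\<close> of an edge with fewer than \<open>k\<close> vertices of colour \<open>True\<close> then lies among the last \<open>k\<close>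
  vertices of another edge.\<close>

lemma property_B_if_no_conflict:
  fixes g :: "'a \<Rightarrow> nat"
  assumes unif: "\<And>e. e \<in> E \<Longrightarrow> card e = n" and fin: "\<And>e. e \<in> E \<Longrightarrow> finite e"
    and inj: "inj_on g (\<Union>E)" and "2 * k \<le> n"
    and no_conflict: "\<And>e f v. e \<in> E \<Longrightarrow> f \<in> E \<Longrightarrow> e \<noteq> f \<Longrightarrow> v \<in> e \<inter> f \<Longrightarrow>
      card {u\<in>e. g v < g u} < k \<Longrightarrow> card {u\<in>f. g u < g v} < k \<Longrightarrow> False"
  shows "property_B k (V, E)"
proof -
  \<comment> \<open>The greedy rule refers to the colours of earlier vertices only, so it is a
    well-founded recursion along \<open>g\<close>.\<close>
  define c where "c = wfrec (Wellfounded.measure g)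
    (\<lambda>c v. \<not> (\<exists>e\<in>E. v \<in> e \<and> n - k \<le> card {u\<in>e. (u, v) \<in> Wellfounded.measure g \<and> c u}))"
  have c: "c v \<longleftrightarrow> \<not> (\<exists>e\<in>E. v \<in> e \<and> n - k \<le> card {u\<in>e. g u < g v \<and> c u})" for v
  proof -
    have "{u\<in>e. (u, v) \<in> Wellfounded.measure g \<and> cut c (Wellfounded.measure g) v u} = {u\<in>e. g u < g v \<and> c u}" for e
      by (auto simp: cut_def)
    then show ?thesis
      unfolding c_def by (subst wfrec) (simp_all add: c_def[symmetric])
  qed
  have split: "card e = card {u\<in>e. c u} + card {u\<in>e. \<not> c u}" if "e \<in> E" for e
    using card_Int_Diff[OF fin[OF that], of "{u. c u}"]
    by (simp add: Int_def set_diff_eq)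
  \<comment> \<open>Otherwise the last vertex of colour \<open>True\<close> in \<open>e\<close>
    would already have had \<open>n - k\<close> such vertices of \<open>e\<close> before it, and the
    rule would have refused it.\<close>
  have few: "card {u\<in>e. c u} \<le> n - k" if e: "e \<in> E" for e
  proof (rule ccontr)
    assume *: "\<not> ?thesis"
    let ?S = "{u\<in>e. c u}"
    have "finite ?S"
      using fin[OF e] by simp
    moreover have "?S \<noteq> {}"
      using * by (metis card.empty le0)
    ultimately have "Max (g ` ?S) \<in> g ` ?S"
      by (intro Max_in) auto
    then obtain v where v: "v \<in> ?S" "g v = Max (g ` ?S)"
      by auto
    have "?S - {v} \<subseteq> {u\<in>e. g u < g v \<and> c u}"
    proof safe
      fix u assume u: "u \<in> e" "c u" "u \<noteq> v"
      then have "g u \<le> g v"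
        using v(2) \<open>finite ?S\<close> by auto
      moreover have "g u \<noteq> g v"
        using inj u v(1) e by (auto dest!: inj_onD)
      ultimately show "g u < g v" by simp
    qed
    then have "card (?S - {v}) \<le> card {u\<in>e. g u < g v \<and> c u}"
      using fin[OF e] by (intro card_mono) auto
    moreover have "card (?S - {v}) = card ?S - 1"
      using v(1) by simp
    ultimately have "n - k \<le> card {u\<in>e. g u < g v \<and> c u}"
      using * by linarith
    with c[of v] v(1) e show False by blast
  qed
  have "k \<le> card {v\<in>e. c v = b}" if e: "e \<in> E" for e b
  proof (cases b)
    case False
    then show ?thesis
      using few[OF e] split[OF e] unif[OF e] \<open>2 * k \<le> n\<close> by simp
  next
    case True
    show ?thesis
    proof (rule ccontr)
      assume "\<not> ?thesis"
      with True have *: "card {u\<in>e. c u} < k" by simp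
      let ?S = "{u\<in>e. \<not> c u}"
      have "finite ?S"
        using fin[OF e] by simp
      moreover have "card ?S \<noteq> 0"
        using * split[OF e] unif[OF e] \<open>2 * k \<le> n\<close> by linarith
      then have "?S \<noteq> {}"
        by (metis card.empty)
      ultimately have "Min (g ` ?S) \<in> g ` ?S"
        by (intro Min_in) auto
      then obtain v where v: "v \<in> ?S" "g v = Min (g ` ?S)"
        by auto
      have "{u\<in>e. g u < g v} \<subseteq> {u\<in>e. c u}"
      proof safe
        fix u assume u: "u \<in> e" "g u < g v"
        show "c u"
        proof (rule ccontr)
          assume "\<not> c u"
          with u(1) have "Min (g ` ?S) \<le> g u"
            using \<open>finite ?S\<close> by (intro Min_le) auto
          with u(2) v(2) show False by simp
        qed
      qed
      then have early: "card {u\<in>e. g u < g v} < k"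
        using * card_mono[of "{u\<in>e. c u}" "{u\<in>e. g u < g v}"] fin[OF e] by simp
      obtain f where f: "f \<in> E" "v \<in> f" "n - k \<le> card {u\<in>f. g u < g v \<and> c u}"
        using c[of v] v(1) by blast
      \<comment> \<open>At least \<open>n - k \<ge> k\<close> vertices of \<open>f\<close> precede
        \<open>v\<close>, but fewer than \<open>k\<close> vertices of \<open>e\<close> do.\<close>
      have "e \<noteq> f"
      proof
        assume "e = f"
        have "card {u\<in>f. g u < g v \<and> c u} \<le> card {u\<in>f. g u < g v}"
          using fin[OF f(1)] by (intro card_mono) auto
        with early f(3) \<open>e = f\<close> \<open>2 * k \<le> n\<close> show False by simp
      qed
      have "card {u\<in>f. g u < g v \<and> c u} + card {u\<in>f. g v < g u} + card {v} \<le> card f"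
      proof -
        let ?A = "{u\<in>f. g u < g v \<and> c u}" and ?B = "{u\<in>f. g v < g u}"
        have "card (?A \<union> ?B \<union> {v}) \<le> card f"
          using fin[OF f(1)] f(2) by (intro card_mono) auto
        moreover have "card (?A \<union> ?B \<union> {v}) = card ?A + card ?B + card {v}"
          using fin[OF f(1)] by (subst card_Un_disjoint | auto)+
        ultimately show ?thesis by simp
      qed
      then have "card {u\<in>f. g v < g u} < k"
        using f(3) unif[OF f(1)] \<open>2 * k \<le> n\<close> by simp
      with early show False
        using no_conflict[of f e v] f e \<open>e \<noteq> f\<close> v(1) by blast
    qed
  qed
  then show ?thesis
    unfolding property_B_def by auto
qed

section \<open>Colouring along random weights\<close>

text \<open>For \<open>0 \<le> z \<le> 1\<close> this is the probability that a binomial variable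
  with parameters \<open>m\<close> and \<open>z\<close> is less than \<open>k\<close>.\<close>

definition binomial_tail :: "nat \<Rightarrow> nat \<Rightarrow> real \<Rightarrow> real" where
  "binomial_tail m k z = (\<Sum>i<k. real (m choose i) * z ^ i * (1 - z) ^ (m - i))"

lemma card_edges_meeting_le:
  fixes \<delta> :: real
  assumes "finite E" "finite S" and deg: "\<And>v. v \<in> S \<Longrightarrow> card {e\<in>E. v \<in> e} \<le> \<delta>"
  shows "card {e\<in>E. e \<inter> S \<noteq> {}} \<le> card S * \<delta>"
proof -
  have "{e\<in>E. e \<inter> S \<noteq> {}} = (\<Union>v\<in>S. {e\<in>E. v \<in> e})"
    by auto
  then have "card {e\<in>E. e \<inter> S \<noteq> {}} \<le> (\<Sum>v\<in>S. card {e\<in>E. v \<in> e})"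
    using assms(2) by (simp add: card_UN_le)
  then have "real (card {e\<in>E. e \<inter> S \<noteq> {}}) \<le> (\<Sum>v\<in>S. real (card {e\<in>E. v \<in> e}))"
    by (simp flip: of_nat_sum)
  also have "\<dots> \<le> (\<Sum>v\<in>S. \<delta>)"
    by (intro sum_mono deg)
  finally show ?thesis by simp
qed

text \<open>One of the two edges meets \<open>S\<close>, which gives the factor 2 by symmetry. There
  are at most \<open>card S * \<delta>\<close> choices for it, and then at most
  \<open>n * \<delta>\<close> for an edge meeting it.\<close>

lemma card_edge_pairs_meeting_le:
  fixes \<delta> :: real
  assumes "finite V" "E \<subseteq> Pow V" and unif: "\<And>e. e \<in> E \<Longrightarrow> card e = n"
    and deg: "\<And>v. v \<in> V \<Longrightarrow> card {e\<in>E. v \<in> e} \<le> \<delta>" and "0 \<le> \<delta>" "S \<subseteq> V"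
  shows "card {(e, f) \<in> E \<times> E. e \<inter> f \<noteq> {} \<and> (e \<union> f) \<inter> S \<noteq> {}} \<le> 2 * (card S * \<delta>) * (n * \<delta>)"
proof -
  let ?P = "SIGMA e:{e\<in>E. e \<inter> S \<noteq> {}}. {f\<in>E. f \<inter> e \<noteq> {}}"
  have fin: "finite E" "finite S" "\<And>e. e \<in> E \<Longrightarrow> finite e"
    using assms(1,2) \<open>S \<subseteq> V\<close> by (auto intro: finite_subset)
  have "{(e, f) \<in> E \<times> E. e \<inter> f \<noteq> {} \<and> (e \<union> f) \<inter> S \<noteq> {}} \<subseteq> ?P \<union> prod.swap ` ?P"
    by (auto simp: image_iff)
  then have "card {(e, f) \<in> E \<times> E. e \<inter> f \<noteq> {} \<and> (e \<union> f) \<inter> S \<noteq> {}} \<le> card (?P \<union> prod.swap ` ?P)"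
    using fin by (intro card_mono) auto
  also have "\<dots> \<le> card ?P + card ?P"
    using card_Un_le[of ?P "prod.swap ` ?P"] by (simp add: card_image)
  finally have "card {(e, f) \<in> E \<times> E. e \<inter> f \<noteq> {} \<and> (e \<union> f) \<inter> S \<noteq> {}} \<le> 2 * card ?P"
    by simp
  then have "real (card {(e, f) \<in> E \<times> E. e \<inter> f \<noteq> {} \<and> (e \<union> f) \<inter> S \<noteq> {}}) \<le> 2 * real (card ?P)"
    by linarith
  also have "real (card ?P) = (\<Sum>e\<in>{e\<in>E. e \<inter> S \<noteq> {}}. real (card {f\<in>E. f \<inter> e \<noteq> {}}))"
    using fin by simp
  also have "\<dots> \<le> (\<Sum>e\<in>{e\<in>E. e \<inter> S \<noteq> {}}. n * \<delta>)"
  proof (rule sum_mono)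
    fix e assume e: "e \<in> {e\<in>E. e \<inter> S \<noteq> {}}"
    show "card {f\<in>E. f \<inter> e \<noteq> {}} \<le> n * \<delta>"
    proof -
      have "e \<in> E" "e \<subseteq> V"
        using e assms(2) by auto
      then show ?thesis
        using card_edges_meeting_le[of E e \<delta>] fin deg unif by (simp add: subset_iff)
    qed
  qed
  also have "\<dots> = card {e\<in>E. e \<inter> S \<noteq> {}} * (n * \<delta>)"
    by simp
  also have "\<dots> \<le> card S * \<delta> * (n * \<delta>)"
    using card_edges_meeting_le[of E S \<delta>] fin deg \<open>S \<subseteq> V\<close> \<open>0 \<le> \<delta>\<close>
    by (intro mult_right_mono) auto
  finally show ?thesis
    by (simp add: mult_ac)
qed

lemma determined_by_eq: "determined_by {w. w v = t} {v}"
  by (simp add: determined_by_def)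

text \<open>Once the value \<open>t\<close> of \<open>w v\<close> is fixed, the three conditions are
  determined by the disjoint sets \<open>{v}\<close>, \<open>e - {v}\<close> and
  \<open>f - {v}\<close>, so their probabilities multiply.\<close>

lemma prob_conflict_le:
  fixes p :: "nat pmf"
  assumes "finite V" "e \<subseteq> V" "f \<subseteq> V" "e \<inter> f = {v}" "card e = n" "card f = n"
  shows "measure_pmf.prob (Pi_pmf V 0 (\<lambda>_. p))
      {w. w v \<in> {l..<r} \<and> card {u\<in>e - {v}. w u \<in> {w v<..}} < k \<and>
        card {u\<in>f - {v}. w u \<in> {..<w v}} < k}
    \<le> (\<Sum>t\<in>{l..<r}. pmf p t * (binomial_tail (n - 1) k (measure_pmf.prob p {t<..}) *
        binomial_tail (n - 1) k (measure_pmf.prob p {..<t})))"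
    (is "measure_pmf.prob ?Q ?C \<le> (\<Sum>t\<in>_. ?b t)")
proof -
  define X where "X t = {w. card {u\<in>e - {v}. w u \<in> {t<..}} < k}" for t :: nat
  define Y where "Y t = {w. card {u\<in>f - {v}. w u \<in> {..<t}} < k}" for t :: nat
  have v: "v \<in> V" "v \<in> e" "v \<in> f"
    using assms by auto
  have fin: "finite e" "finite f"
    using assms finite_subset by blast+
  have XY: "determined_by (X t) (e - {v})" "determined_by (Y t) (f - {v})" for t
    unfolding X_def Y_def by (rule determined_by_card)+
  have "?C \<subseteq> (\<Union>t\<in>{l..<r}. {w. w v = t} \<inter> (X t \<inter> Y t))"
    by (auto simp: X_def Y_def)
  then have "measure_pmf.prob ?Q ?C \<le> measure_pmf.prob ?Q (\<Union>t\<in>{l..<r}. {w. w v = t} \<inter> (X t \<inter> Y t))"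
    by (intro measure_pmf.finite_measure_mono) auto
  also have "\<dots> \<le> (\<Sum>t\<in>{l..<r}. measure_pmf.prob ?Q ({w. w v = t} \<inter> (X t \<inter> Y t)))"
    by (intro measure_pmf.finite_measure_subadditive_finite) auto
  also have "\<dots> = (\<Sum>t\<in>{l..<r}. ?b t)"
  proof (rule sum.cong)
    fix t
    have "measure_pmf.prob ?Q ({w. w v = t} \<inter> (X t \<inter> Y t)) =
        measure_pmf.prob ?Q {w. w v = t} * measure_pmf.prob ?Q (X t \<inter> Y t)"
      using assms v XY by (intro prob_Pi_pmf_Int[where X = "{v}" and Y = "(e - {v}) \<union> (f - {v})"])
        (auto intro: determined_by_eq determined_by_Int)
    also have "measure_pmf.prob ?Q (X t \<inter> Y t) = measure_pmf.prob ?Q (X t) * measure_pmf.prob ?Q (Y t)"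
      using assms v XY by (intro prob_Pi_pmf_Int[where X = "e - {v}" and Y = "f - {v}"]) auto
    also have "measure_pmf.prob ?Q (X t) = binomial_tail (n - 1) k (measure_pmf.prob p {t<..})"
      unfolding X_def binomial_tail_def
      using prob_Pi_pmf_card_less[OF assms(1), of "e - {v}" 0 p "{t<..}" k] assms v fin by auto
    also have "measure_pmf.prob ?Q (Y t) = binomial_tail (n - 1) k (measure_pmf.prob p {..<t})"
      unfolding Y_def binomial_tail_def
      using prob_Pi_pmf_card_less[OF assms(1), of "f - {v}" 0 p "{..<t}" k] assms v fin by auto
    also have "measure_pmf.prob ?Q {w. w v = t} = pmf p t"
      using assms v by (intro prob_Pi_pmf_component)
    finally show "measure_pmf.prob ?Q ({w. w v = t} \<inter> (X t \<inter> Y t)) = ?b t" .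
  qed auto
  finally show ?thesis .
qed

text \<open>Vertices are ordered by independent weights with distribution \<open>p\<close>, ties being broken arbitrarily.
  A conflict at a vertex with weight outside the window \<open>{l..<r}\<close> forces almost all vertices of a
  single edge to one side of the window.\<close>

lemma property_B_if_random_weights:
  fixes p :: "nat pmf" and \<delta> q1 q2 :: real
  assumes "finite V" "E \<subseteq> Pow V" and unif: "\<And>e. e \<in> E \<Longrightarrow> card e = n"
    and simple: "\<And>e f. e \<in> E \<Longrightarrow> f \<in> E \<Longrightarrow> e \<noteq> f \<Longrightarrow> card (e \<inter> f) \<le> 1"
    and "2 * k \<le> n" "0 < n"
    and deg: "\<And>v. v \<in> V \<Longrightarrow> card {e\<in>E. v \<in> e} \<le> \<delta>" and "0 \<le> \<delta>"
    and q1: "binomial_tail n k (measure_pmf.prob p {l..}) +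
      binomial_tail n k (measure_pmf.prob p {..<r}) \<le> q1"
    and q2: "(\<Sum>t\<in>{l..<r}. pmf p t * (binomial_tail (n - 1) k (measure_pmf.prob p {t<..}) *
      binomial_tail (n - 1) k (measure_pmf.prob p {..<t}))) \<le> q2"
    and small: "2 * n * \<delta> * q1 + 4 * n ^ 2 * \<delta> ^ 2 * q2 \<le> 1 / 4"
  shows "property_B k (V, E)"
proof -
  let ?Q = "Pi_pmf V 0 (\<lambda>_. p)"
  \<comment> \<open>The pair \<open>(e, e)\<close> indexes the event that all but fewer than \<open>k\<close> weights in \<open>e\<close> lie below \<open>l\<close>,
    or all but fewer than \<open>k\<close> are at least \<open>r\<close>; a pair of distinct edges indexes a conflict
    in the window.\<close>
  define I where "I = {(e, f) \<in> E \<times> E. e \<inter> f \<noteq> {}}"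
  define extreme where "extreme e = {w. card {u\<in>e. w u \<in> {l..}} < k} \<union>
    {w. card {u\<in>e. w u \<in> {..<r}} < k}" for e :: "'a set"
  define conflict where "conflict v e f = {w. w v \<in> {l..<r} \<and>
    card {u\<in>e - {v}. w u \<in> {w v<..}} < k \<and> card {u\<in>f - {v}. w u \<in> {..<w v}} < k}" for v and e f :: "'a set"
  define bad where "bad = (\<lambda>(e, f). if e = f then extreme e else \<Union>v\<in>e \<inter> f. conflict v e f)"
  define vars where "vars = (\<lambda>(e, f). e \<union> f :: 'a set)"
  have fin: "finite E" "\<And>e. e \<in> E \<Longrightarrow> finite e"
    using assms(1,2) by (auto intro: finite_subset)
  then have "finite I"
    by (auto simp: I_def intro: finite_subset[of _ "E \<times> E"])
  have det_conflict: "determined_by (conflict v e f) (e \<union> f)" if v: "v \<in> e \<inter> f" for v e f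
  proof -
    have "w' \<in> conflict v e f" if eq: "\<forall>x\<in>e \<union> f. w x = w' x" and w: "w \<in> conflict v e f" for w w'
    proof -
      have "w' v = w v"
        using eq v by auto
      moreover have "{u\<in>e - {v}. w' u \<in> {w v<..}} = {u\<in>e - {v}. w u \<in> {w v<..}}"
          "{u\<in>f - {v}. w' u \<in> {..<w v}} = {u\<in>f - {v}. w u \<in> {..<w v}}"
        using eq by auto
      ultimately show ?thesis
        using w by (simp add: conflict_def)
    qed
    then show ?thesis
      unfolding determined_by_def by blast
  qed
  have det_extreme: "determined_by (extreme e) e" for e
    using determined_by_card[of e "\<lambda>x. x \<in> {l..}" k] determined_by_card[of e "\<lambda>x. x \<in> {..<r}" k]
    unfolding extreme_def determined_by_def Un_iff by blast
  have det: "determined_by (bad i) (vars i)" for i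
  proof (cases i)
    case (Pair e f)
    show ?thesis
    proof (cases "e = f")
      case True
      then show ?thesis
        using det_extreme Pair by (simp add: bad_def vars_def)
    next
      case False
      have "determined_by (\<Union>v\<in>e \<inter> f. conflict v e f) (e \<union> f)"
        using det_conflict[of _ e f] unfolding determined_by_def by blast
      with False Pair show ?thesis
        by (simp add: bad_def vars_def)
    qed
  qed
  have prob_extreme: "measure_pmf.prob ?Q (extreme e) \<le> q1" if e: "e \<in> E" for e
  proof -
    have "measure_pmf.prob ?Q (extreme e) \<le> measure_pmf.prob ?Q {w. card {u\<in>e. w u \<in> {l..}} < k} +
        measure_pmf.prob ?Q {w. card {u\<in>e. w u \<in> {..<r}} < k}"
      unfolding extreme_def by (intro measure_Un_le) auto
    also have "\<dots> = binomial_tail n k (measure_pmf.prob p {l..}) + binomial_tail n k (measure_pmf.prob p {..<r})"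
      using prob_Pi_pmf_card_less[OF assms(1), of e 0 p "{l..}" k]
        prob_Pi_pmf_card_less[OF assms(1), of e 0 p "{..<r}" k] unif[OF e] assms(2) e
      by (auto simp: binomial_tail_def)
    finally show ?thesis
      using q1 by simp
  qed
  have prob_conflict: "measure_pmf.prob ?Q (bad (e, f)) \<le> q2" if i: "(e, f) \<in> I" "e \<noteq> f" for e f
  proof -
    have ef: "e \<in> E" "f \<in> E" "e \<inter> f \<noteq> {}"
      using i by (auto simp: I_def)
    moreover have "finite (e \<inter> f)"
      using fin ef by simp
    ultimately have "card (e \<inter> f) = 1"
      using simple[of e f] i(2) by (metis One_nat_def Suc_leI card_gt_0_iff le_antisym)
    then obtain v where v: "e \<inter> f = {v}"
      by (auto simp: card_1_singleton_iff)
    have "bad (e, f) = conflict v e f"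
      using i(2) v by (simp add: bad_def)
    moreover have "measure_pmf.prob ?Q (conflict v e f) \<le> (\<Sum>t\<in>{l..<r}. pmf p t *
        (binomial_tail (n - 1) k (measure_pmf.prob p {t<..}) *
        binomial_tail (n - 1) k (measure_pmf.prob p {..<t})))"
      unfolding conflict_def using assms(2) ef unif
      by (intro prob_conflict_le[OF assms(1) _ _ v]) auto
    ultimately show ?thesis
      using q2 by simp
  qed
  have "measure_pmf.prob ?Q (space ?Q - \<Union>(bad ` I)) > 0"
  \<comment> \<open>Two events are dependent when their pairs of edges share a vertex. Avoiding all
    events independent of \<open>i\<close> is determined by vertices outside \<open>vars i\<close>,
    which gives the required product formula.\<close>
  proof (rule measure_pmf.local_lemma[where dep = "\<lambda>i j. vars i \<inter> vars j \<noteq> {}"])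
    show "finite I" by fact
    show "vars i \<inter> vars i \<noteq> {}" if "i \<in> I" for i
      using that by (auto simp: I_def vars_def)
    show "measure_pmf.prob ?Q (bad i \<inter> (space ?Q - \<Union>(bad ` S))) =
        measure_pmf.prob ?Q (bad i) * measure_pmf.prob ?Q (space ?Q - \<Union>(bad ` S))"
      if "i \<in> I" "S \<subseteq> I" "\<And>j. j \<in> S \<Longrightarrow> \<not> vars i \<inter> vars j \<noteq> {}" for i S
    proof -
      have "determined_by (- \<Union>(bad ` S)) (\<Union>(vars ` S))"
        by (intro determined_by_Compl_UN det)
      moreover have "vars i \<subseteq> V"
        using that(1) assms(2) by (auto simp: vars_def I_def)
      ultimately show ?thesis
        using prob_Pi_pmf_Int[OF assms(1) \<open>vars i \<subseteq> V\<close> _ det[of i], of "\<Union>(vars ` S)" "- \<Union>(bad ` S)"] that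
        by (simp add: Compl_eq_Diff_UNIV disjoint_iff)
    qed
    show "(\<Sum>j\<in>{j\<in>I. vars i \<inter> vars j \<noteq> {}}. measure_pmf.prob ?Q (bad j)) \<le> 1 / 4"
      if i: "i \<in> I" for i
    proof -
      define S where "S = vars i"
      obtain e0 f0 where i_eq: "i = (e0, f0)" and "e0 \<in> E" "f0 \<in> E"
        using i by (auto simp: I_def)
      then have S: "S \<subseteq> V" "card S \<le> 2 * n"
        using assms(2) card_Un_le[of e0 f0] unif by (auto simp: S_def vars_def)
      have S\<delta>: "card S * \<delta> \<le> 2 * n * \<delta>"
        using S(2) \<open>0 \<le> \<delta>\<close> by (intro mult_right_mono) linarith+
      have "finite S"
        using S(1) assms(1) finite_subset by blast
      have "0 \<le> q1"
        using prob_extreme[OF \<open>e0 \<in> E\<close>] by (meson measure_nonneg order_trans)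
      have "0 \<le> q2"
        using q2 by (rule order_trans[rotated])
          (auto intro!: sum_nonneg mult_nonneg_nonneg simp: binomial_tail_def measure_pmf.prob_le_1)
      let ?J = "{j\<in>I. S \<inter> vars j \<noteq> {}}"
      let ?D = "{j\<in>?J. fst j = snd j}" and ?N = "{j\<in>?J. fst j \<noteq> snd j}"
      \<comment> \<open>The pair \<open>i\<close> covers at most \<open>2 * n\<close> vertices, so
        it meets at most \<open>2 * n * \<delta>\<close> diagonal pairs and
        \<open>4 * n ^ 2 * \<delta> ^ 2\<close> pairs of distinct edges: the two terms of the
        hypothesis \<open>small\<close>.\<close>
      have "(\<Sum>j\<in>?J. measure_pmf.prob ?Q (bad j)) =
          (\<Sum>j\<in>?D. measure_pmf.prob ?Q (bad j)) + (\<Sum>j\<in>?N. measure_pmf.prob ?Q (bad j))"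
        using \<open>finite I\<close> by (subst sum.union_disjoint[symmetric]) (auto intro!: sum.cong)
      also have "(\<Sum>j\<in>?D. measure_pmf.prob ?Q (bad j)) \<le> (\<Sum>j\<in>?D. q1)"
        using prob_extreme by (intro sum_mono) (auto simp: I_def bad_def)
      also have "(\<Sum>j\<in>?N. measure_pmf.prob ?Q (bad j)) \<le> (\<Sum>j\<in>?N. q2)"
      proof (rule sum_mono)
        fix j assume "j \<in> ?N"
        then show "measure_pmf.prob ?Q (bad j) \<le> q2"
          using prob_conflict[of "fst j" "snd j"] by simp
      qed
      also have "(\<Sum>j\<in>?D. q1) \<le> 2 * n * \<delta> * q1"
      proof -
        have "?D \<subseteq> (\<lambda>e. (e, e)) ` {e\<in>E. e \<inter> S \<noteq> {}}"
          by (auto simp: I_def vars_def)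
        then have "card ?D \<le> card {e\<in>E. e \<inter> S \<noteq> {}}"
          using fin(1) by (intro surj_card_le) auto
        moreover have "card {e\<in>E. e \<inter> S \<noteq> {}} \<le> card S * \<delta>"
          using fin(1) \<open>finite S\<close> S(1) deg by (intro card_edges_meeting_le) auto
        ultimately have "card ?D \<le> 2 * n * \<delta>"
          using S\<delta> by linarith
        then show ?thesis
          using \<open>0 \<le> q1\<close> by (simp add: mult_right_mono)
      qed
      also have "(\<Sum>j\<in>?N. q2) \<le> 4 * n ^ 2 * \<delta> ^ 2 * q2"
      proof -
        have "finite {(e, f) \<in> E \<times> E. e \<inter> f \<noteq> {} \<and> (e \<union> f) \<inter> S \<noteq> {}}"
          using fin(1) by (rule_tac finite_subset[of _ "E \<times> E"]) blast+
        moreover have "?N \<subseteq> {(e, f) \<in> E \<times> E. e \<inter> f \<noteq> {} \<and> (e \<union> f) \<inter> S \<noteq> {}}"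
        proof (rule subsetI)
          fix j assume "j \<in> ?N"
          then show "j \<in> {(e, f) \<in> E \<times> E. e \<inter> f \<noteq> {} \<and> (e \<union> f) \<inter> S \<noteq> {}}"
            by (cases j) (simp add: I_def vars_def Int_commute)
        qed
        ultimately have "card ?N \<le> card {(e, f) \<in> E \<times> E. e \<inter> f \<noteq> {} \<and> (e \<union> f) \<inter> S \<noteq> {}}"
          by (rule card_mono)
        moreover have "card {(e, f) \<in> E \<times> E. e \<inter> f \<noteq> {} \<and> (e \<union> f) \<inter> S \<noteq> {}} \<le>
            2 * (card S * \<delta>) * (n * \<delta>)"
          using assms(1,2) S(1) unif deg \<open>0 \<le> \<delta>\<close> by (intro card_edge_pairs_meeting_le) auto
        moreover have "2 * (card S * \<delta>) * (n * \<delta>) \<le> 2 * (2 * n * \<delta>) * (n * \<delta>)"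
          using mult_right_mono[OF mult_left_mono[OF S\<delta>, of 2], of "n * \<delta>"] \<open>0 \<le> \<delta>\<close> by simp
        ultimately have "card ?N \<le> 4 * n ^ 2 * \<delta> ^ 2"
          by (simp add: power2_eq_square mult_ac)
        then show ?thesis
          using \<open>0 \<le> q2\<close> by (simp add: mult_right_mono)
      qed
      finally show ?thesis
        using small by (simp add: S_def)
    qed
  qed auto
  note pos = this
  obtain w where w: "\<And>i. i \<in> I \<Longrightarrow> w \<notin> bad i"
  proof -
    have "space ?Q - \<Union>(bad ` I) \<noteq> {}"
      using pos by (metis less_irrefl measure_empty)
    then show ?thesis
      using that by blast
  qed
  \<comment> \<open>Since \<open>\<iota>\<close> takes values below \<open>m\<close> on
    \<open>V\<close>, the number \<open>w u * m + \<iota> u\<close> sorts vertices by weight and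
    breaks ties injectively.\<close>
  obtain \<iota> m where "\<iota> ` V = {i. i < (m :: nat)}" and inj: "inj_on \<iota> V"
    using finite_imp_inj_to_nat_seg[OF assms(1)] by blast
  then have \<iota>: "\<iota> u < m" if "u \<in> V" for u
    using that by auto
  define g where "g u = w u * m + \<iota> u" for u
  have g_less: "g u < g v" if "w u < w v" "u \<in> V" for u v
  proof -
    have "g u < Suc (w u) * m"
      using \<iota>[OF that(2)] by (simp add: g_def)
    also have "\<dots> \<le> w v * m"
      using that(1) by (intro mult_right_mono) auto
    finally show ?thesis
      by (simp add: g_def)
  qed
  show ?thesis
  proof (rule property_B_if_no_conflict[where g = g and n = n])
    show "inj_on g (\<Union>E)"
    proof (rule inj_onI)
      fix u v assume uv: "u \<in> \<Union>E" "v \<in> \<Union>E" and eq: "g u = g v"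
      have "u \<in> V" "v \<in> V"
        using uv assms(2) by auto
      moreover have "w u = w v"
        using g_less[of u v] g_less[of v u] eq calculation by (metis less_irrefl linorder_neqE_nat)
      ultimately show "u = v"
        using inj eq by (auto simp: g_def dest: inj_onD)
    qed
  next
    fix e f v
    assume ef: "e \<in> E" "f \<in> E" "e \<noteq> f" "v \<in> e \<inter> f"
      and few: "card {u\<in>e. g v < g u} < k" "card {u\<in>f. g u < g v} < k"
    have le: "w u \<le> w v" if "\<not> g v < g u" "v \<in> V" for u
      using g_less[of v u] that by force
    have late: "card {u\<in>e. w v < w u} < k"
    proof -
      have "card {u\<in>e. w v < w u} \<le> card {u\<in>e. g v < g u}"
        using g_less ef assms(2) fin by (intro card_mono) auto
      with few(1) show ?thesis by simp
    qed
    have early: "card {u\<in>f. w u < w v} < k"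
    proof -
      have "card {u\<in>f. w u < w v} \<le> card {u\<in>f. g u < g v}"
        using g_less ef assms(2) fin by (intro card_mono) auto
      with few(2) show ?thesis by simp
    qed
    have diag: "(e, e) \<in> I" "(f, f) \<in> I" and "(e, f) \<in> I"
      using ef by (auto simp: I_def)
    \<comment> \<open>Below the window, vertices of \<open>e\<close> with weight at least
      \<open>l\<close> are heavier than \<open>v\<close>, hence few; above it, vertices of
      \<open>f\<close> with weight below \<open>r\<close> are lighter than \<open>v\<close>, hence
      few.\<close>
    consider "w v < l" | "r \<le> w v" | "w v \<in> {l..<r}"
      by force
    then show False
    proof cases
      case 1
      have "card {u\<in>e. w u \<in> {l..}} \<le> card {u\<in>e. w v < w u}"
        using 1 fin ef by (intro card_mono) auto
      with late have "w \<in> bad (e, e)"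
        by (simp add: bad_def extreme_def)
      with w diag show False by blast
    next
      case 2
      have "card {u\<in>f. w u \<in> {..<r}} \<le> card {u\<in>f. w u < w v}"
        using 2 fin ef by (intro card_mono) auto
      with early have "w \<in> bad (f, f)"
        by (simp add: bad_def extreme_def)
      with w diag show False by blast
    next
      case 3
      have "card {u\<in>e - {v}. w u \<in> {w v<..}} \<le> card {u\<in>e. w v < w u}"
          "card {u\<in>f - {v}. w u \<in> {..<w v}} \<le> card {u\<in>f. w u < w v}"
        using fin ef by (auto intro!: card_mono)
      with late early 3 have "w \<in> conflict v e f"
        by (simp add: conflict_def)
      with ef have "w \<in> bad (e, f)"
        by (auto simp: bad_def)
      with w \<open>(e, f) \<in> I\<close> show False by blast
    qed
  qed (use unif fin \<open>2 * k \<le> n\<close> in auto)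
qed

section \<open>Hypergraphs of small degree\<close>

text \<open>Up to index \<open>k\<close> the coefficients at least double at each step, because the
  ratio of consecutive ones, \<open>(m - k) / (k + 1)\<close> before the last step, is at least 2.
  The sum is dominated by a geometric series.\<close>

lemma sum_binomial_le:
  assumes "3 * k \<le> m + 1"
  shows "(\<Sum>i\<le>k. m choose i) \<le> 2 * (m choose k)"
  using assms
proof (induction k)
  case (Suc k)
  have "2 * (Suc k) * (m choose k) \<le> (m - k) * (m choose k)"
    using Suc.prems by (intro mult_right_mono) auto
  also have "\<dots> = Suc k * (m choose Suc k)"
    by (simp only: binomial_absorb_comp binomial_absorption)
  finally have "2 * (m choose k) \<le> m choose Suc k"
    by (metis mult.assoc mult.commute mult_le_cancel1 zero_less_Suc)
  with Suc show ?case by simp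
qed simp

text \<open>Replacing \<open>1 - z\<close> by \<open>x\<close> and \<open>z\<close> by
  \<open>\<rho> * x\<close> turns every term into a coefficient times at most
  \<open>\<rho> ^ (k - 1) * x ^ m\<close>; the last coefficient controls the sum up to a factor 2.
  Allowing any \<open>x\<close> above \<open>1 - z\<close> leaves room for ties between
  weights.\<close>

lemma binomial_tail_le:
  assumes "1 \<le> k" "3 * k \<le> m + 1" and z: "0 \<le> z" "z \<le> 1"
    and x: "1 - z \<le> x" "z \<le> \<rho> * x" and "1 \<le> \<rho>"
  shows "binomial_tail m k z \<le> 2 * real (m choose (k - 1)) * \<rho> ^ (k - 1) * x ^ m"
proof -
  have "0 \<le> x"
    using x z by linarith
  have "binomial_tail m k z \<le> (\<Sum>i<k. real (m choose i) * (\<rho> ^ (k - 1) * x ^ m))"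
    unfolding binomial_tail_def
  proof (rule sum_mono)
    fix i assume "i \<in> {..<k}"
    then have i: "i \<le> k - 1" "i \<le> m"
      using assms(1,2) by auto
    have "z ^ i * (1 - z) ^ (m - i) \<le> (\<rho> * x) ^ i * x ^ (m - i)"
      using x z \<open>0 \<le> x\<close> \<open>1 \<le> \<rho>\<close> by (intro mult_mono power_mono) auto
    also have "\<dots> = \<rho> ^ i * x ^ m"
      using i(2) by (simp add: power_mult_distrib mult.assoc flip: power_add)
    also have "\<dots> \<le> \<rho> ^ (k - 1) * x ^ m"
      using i(1) \<open>0 \<le> x\<close> \<open>1 \<le> \<rho>\<close> by (intro mult_right_mono power_increasing) auto
    finally show "real (m choose i) * z ^ i * (1 - z) ^ (m - i) \<le>
        real (m choose i) * (\<rho> ^ (k - 1) * x ^ m)"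
      by (simp add: mult.assoc mult_left_mono)
  qed
  also have "\<dots> = real (\<Sum>i\<le>k - 1. m choose i) * (\<rho> ^ (k - 1) * x ^ m)"
    using assms(1) by (simp add: sum_distrib_right lessThan_Suc_atMost[symmetric])
  also have "\<dots> \<le> real (2 * (m choose (k - 1))) * (\<rho> ^ (k - 1) * x ^ m)"
    using sum_binomial_le[of "k - 1" m] assms(2) \<open>0 \<le> x\<close> \<open>1 \<le> \<rho>\<close>
    by (intro mult_right_mono) (simp_all only: of_nat_le_iff, auto)
  finally show ?thesis
    by simp
qed

lemma prob_pmf_of_set_lessThan:
  fixes m :: nat
  assumes "0 < m"
  shows "measure_pmf.prob (pmf_of_set {..<m}) A = card ({..<m} \<inter> A) / m"
  using assms by (subst measure_pmf_of_set) auto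

text \<open>The weights are uniform on \<open>2 * N\<close> values, and the window has half-length
  \<open>h\<close>, about \<open>ln N\<close>. It is wide enough that
  \<open>(1 - h / N) ^ N \<le> 1 / N\<close>, and narrow enough that the ratio \<open>\<rho>\<close>
  of the two sides satisfies \<open>\<rho> ^ (k - 1) \<le> exp 5\<close>.\<close>

lemma property_B_if_small_degree:
  fixes \<delta> :: real
  assumes N: "29 \<le> N" and k: "2 \<le> k" and kN: "real k ^ 2 * ln (N + 1) \<le> N + 1"
    and \<delta>: "\<delta> = 2 ^ N / (exp 12 * real ((N - 1) choose (k - 1)) * sqrt (N * ln N))"
    and "finite V" "E \<subseteq> Pow V" and unif: "\<And>e. e \<in> E \<Longrightarrow> card e = N"
    and simple: "\<And>e f. e \<in> E \<Longrightarrow> f \<in> E \<Longrightarrow> e \<noteq> f \<Longrightarrow> card (e \<inter> f) \<le> 1"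
    and deg: "\<And>v. v \<in> V \<Longrightarrow> card {e\<in>E. v \<in> e} \<le> \<delta>"
  shows "property_B k (V, E)"
proof -
  define h where "h = nat \<lceil>ln N\<rceil>"
  define b where "b = real ((N - 1) choose (k - 1))"
  define \<rho> where "\<rho> = real (N + h) / real (N - h)"
  define p where "p = pmf_of_set {..<2 * N}"
  have exp3: "exp 3 \<le> (29 :: real)"
  proof -
    have "exp (3 :: real) = exp 1 ^ 3"
      by (simp flip: exp_of_nat_mult)
    also have "\<dots> \<le> 3 ^ 3"
      using exp_le by (intro power_mono) auto
    finally show ?thesis by simp
  qed
  have lnN: "3 \<le> ln N"
    using exp3 N by (subst ln_ge_iff) auto
  have "ln N \<le> ln (N + 1)"
    using N by simp
  have h: "ln N \<le> h" "h \<le> 2 * ln N"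
    using lnN by (simp_all add: h_def) linarith
  \<comment> \<open>The factor 2 lost by rounding up \<open>ln N\<close> is absorbed by one factor
    \<open>k \<ge> 2\<close>, so the hypothesis on \<open>k\<^sup>2\<close> still bounds
    \<open>k * h\<close>.\<close>
  have "real k * real h \<le> real k * (2 * ln N)"
    using h by (intro mult_left_mono) auto
  also have "\<dots> \<le> real k * (real k * ln (N + 1))"
    using k lnN \<open>ln N \<le> ln (N + 1)\<close> by (intro mult_left_mono mult_mono) auto
  also have "\<dots> \<le> N + 1"
    using kN by (simp add: power2_eq_square add.commute mult.assoc)
  finally have kh: "k * h \<le> N + 1"
    by (simp flip: of_nat_mult)
  have "2 * h \<le> k * h"
    using k by (rule mult_right_mono) simp
  with kh have h2: "2 * h \<le> N + 1"
    by (rule order_trans[rotated])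
  have hN: "h < N" "0 < h"
    using h2 N h lnN by (auto intro!: gr0I)
  have "real k * (2 * 3) \<le> real k * (real k * ln (N + 1))"
    using k lnN \<open>ln N \<le> ln (N + 1)\<close> by (intro mult_left_mono mult_mono) auto
  with kN have "6 * k \<le> N + 1"
    by (simp add: power2_eq_square add.commute mult.assoc)
  then have k3: "3 * k \<le> N - 1 + 1"
    using N by simp
  have \<rho>1: "1 \<le> \<rho>"
    using hN by (simp add: \<rho>_def)
  have "\<rho> ^ (k - 1) \<le> exp 5"
  proof -
    have "\<rho> = 1 + 2 * h / real (N - h)"
      using hN by (simp add: \<rho>_def field_simps of_nat_diff)
    also have "\<dots> \<le> exp (2 * h / real (N - h))"
      by (rule exp_ge_add_one_self)
    finally have "\<rho> ^ (k - 1) \<le> exp (2 * h / real (N - h)) ^ (k - 1)"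
      using \<rho>1 by (intro power_mono) auto
    also have "\<dots> = exp (real (k - 1) * (2 * h / real (N - h)))"
      by (simp flip: exp_of_nat_mult)
    also have "real (k - 1) * (2 * h / real (N - h)) \<le> 5"
    proof -
      have "(k - 1) * (2 * h) + 2 * h \<le> 2 * (N + 1)"
        using kh k by (simp add: diff_mult_distrib)
      also have "\<dots> \<le> 5 * (N - h) + 2 * h"
        using h2 N by presburger
      finally have "(k - 1) * (2 * h) \<le> 5 * (N - h)"
        by (rule add_le_imp_le_right)
      then have "real (k - 1) * (2 * real h) \<le> 5 * real (N - h)"
        by (metis of_nat_le_iff of_nat_mult of_nat_numeral)
      then show ?thesis
        using hN by (simp add: field_simps)
    qed
    finally show ?thesis by simp
  qed
  then have tail: "binomial_tail m k z \<le> 2 * real (m choose (k - 1)) * exp 5 * x ^ m"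
    if "N - 1 \<le> m" "0 \<le> z" "z \<le> 1" "1 - z \<le> x" "z \<le> \<rho> * x" for m z x
  proof -
    have "binomial_tail m k z \<le> 2 * real (m choose (k - 1)) * \<rho> ^ (k - 1) * x ^ m"
      using that k k3 \<rho>1 by (intro binomial_tail_le) auto
    also have "\<dots> \<le> 2 * real (m choose (k - 1)) * exp 5 * x ^ m"
      using that \<open>\<rho> ^ (k - 1) \<le> exp 5\<close> by (intro mult_right_mono mult_left_mono) auto
    finally show ?thesis .
  qed
  have "0 < b"
    using k3 k N by (simp add: b_def)
  have prob: "measure_pmf.prob p A = card ({..<2 * N} \<inter> A) / (2 * N)" for A
    using prob_pmf_of_set_lessThan[of "2 * N"] N by (simp add: p_def)

  \<comment> \<open>By symmetry both extreme events have this probability. Here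
    \<open>x = (N - h) / (2 * N)\<close> meets both conditions of \<open>tail\<close> with
    equality.\<close>
  have "binomial_tail N k (real (N + h) / (2 * N)) \<le> 4 * b * exp 5 / (2 ^ N * N)"
  proof -
    have pow: "(real (N - h) / (2 * N)) ^ N \<le> 1 / (2 ^ N * N)"
    proof -
      have "real (N - h) / N = 1 + - (h / N)"
        using hN by (simp add: field_simps of_nat_diff)
      also have "\<dots> \<le> exp (- (h / N))"
        by (rule exp_ge_add_one_self)
      finally have "(real (N - h) / N) ^ N \<le> exp (- (h / N)) ^ N"
        by (intro power_mono) auto
      also have "\<dots> = exp (- real h)"
        using N by (simp flip: exp_of_nat_mult)
      also have "\<dots> \<le> exp (- ln N)"
        using h(1) by simp
      also have "\<dots> = 1 / N"
        using N by (simp add: exp_minus inverse_eq_divide)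
      finally have "(real (N - h) / N) ^ N / 2 ^ N \<le> 1 / N / 2 ^ N"
        by (intro divide_right_mono) auto
      then show ?thesis
        by (simp add: power_divide power_mult_distrib mult_ac)
    qed
    have choose: "real (N choose (k - 1)) \<le> 2 * b"
    proof -
      have "N choose (k - 1) = ((N - 1) choose (k - 2)) + ((N - 1) choose (k - 1))"
        using binomial_Suc_Suc[of "N - 1" "k - 2"] N k
        by (simp add: numeral_2_eq_2 Suc_diff_Suc)
      also have "(N - 1) choose (k - 2) \<le> (N - 1) choose (k - 1)"
        using k3 k by (intro binomial_mono) auto
      finally show ?thesis
        unfolding b_def by linarith
    qed
    have "binomial_tail N k (real (N + h) / (2 * N)) \<le>
        2 * real (N choose (k - 1)) * exp 5 * (real (N - h) / (2 * N)) ^ N"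
      using hN by (intro tail) (auto simp: \<rho>_def field_simps of_nat_diff)
    also have "\<dots> \<le> 2 * real (N choose (k - 1)) * exp 5 * (1 / (2 ^ N * N))"
      by (rule mult_left_mono[OF pow]) simp
    also have "\<dots> \<le> 2 * (2 * b) * exp 5 * (1 / (2 ^ N * N))"
      by (rule mult_right_mono[OF mult_right_mono[OF mult_left_mono[OF choose]]]) simp_all
    finally show ?thesis
      by simp
  qed
  moreover have "{..<2 * N} \<inter> {N - h..} = {N - h..<2 * N}" "{..<2 * N} \<inter> {..<N + h} = {..<N + h}"
    using hN by auto
  then have "measure_pmf.prob p {N - h..} = real (N + h) / (2 * N)"
      "measure_pmf.prob p {..<N + h} = real (N + h) / (2 * N)"
    using hN by (simp_all add: prob of_nat_diff)
  ultimately have q1: "binomial_tail N k (measure_pmf.prob p {N - h..}) +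
      binomial_tail N k (measure_pmf.prob p {..<N + h}) \<le> 8 * b * exp 5 / (2 ^ N * N)"
    by simp

  have conflict: "pmf p t * (binomial_tail (N - 1) k (measure_pmf.prob p {t<..}) *
      binomial_tail (N - 1) k (measure_pmf.prob p {..<t})) \<le>
      1 / (2 * N) * (16 * b\<^sup>2 * exp 11 / 4 ^ N)" if t: "t \<in> {N - h..<N + h}" for t
  proof -
    \<comment> \<open>\<open>x\<close> and \<open>y\<close> are the probabilities of a weight at
      most \<open>t\<close> and at least \<open>t\<close>. The value \<open>t\<close> counts in
      both, so they add up to \<open>1 + 1 / (2 * N)\<close>; by the inequality of arithmetic and
      geometric means this costs only a factor \<open>exp 1\<close> in
      \<open>(x * y) ^ (N - 1)\<close>.\<close>
    define x where "x = real (t + 1) / (2 * N)"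
    define y where "y = real (2 * N - t) / (2 * N)"
    have t': "t < 2 * N"
      using t hN by simp
    have xy: "(x * y) ^ (N - 1) \<le> 4 * exp 1 / 4 ^ N"
    proof -
      have "x + y = 1 + 1 / (2 * N)"
        using t' N by (simp add: x_def y_def field_simps of_nat_diff)
      moreover have "4 * (x * y) \<le> (x + y)\<^sup>2"
        using zero_le_power2[of "x - y"] by (simp add: power2_eq_square algebra_simps)
      moreover have "(1 + 1 / (2 * N))\<^sup>2 \<le> (exp (1 / (2 * N)))\<^sup>2"
        by (intro power_mono exp_ge_add_one_self) auto
      moreover have "(exp (1 / (2 * N)))\<^sup>2 = exp (1 / N)"
        by (simp flip: exp_of_nat_mult)
      ultimately have "4 * (x * y) \<le> exp (1 / N)"
        by (metis order_trans)
      then have "(4 * (x * y)) ^ (N - 1) \<le> exp (1 / N) ^ (N - 1)"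
        by (intro power_mono) (auto simp: x_def y_def)
      also have "\<dots> \<le> exp 1"
        using N by (simp flip: exp_of_nat_mult)
      finally have "4 ^ (N - 1) * (x * y) ^ (N - 1) \<le> exp 1"
        by (simp only: power_mult_distrib)
      moreover have "(4 :: real) ^ N = 4 * 4 ^ (N - 1)"
        using N by (simp add: power_eq_if)
      ultimately show ?thesis
        by (simp add: field_simps)
    qed
    have "pmf p t = 1 / (2 * N)"
      unfolding p_def using t' N by (subst pmf_of_set) (auto simp: indicator_def)
    moreover have "{..<2 * N} \<inter> {t<..} = {Suc t..<2 * N}" "{..<2 * N} \<inter> {..<t} = {..<t}"
      using t' by auto
    then have pr: "measure_pmf.prob p {t<..} = real (2 * N - Suc t) / (2 * N)"
        "measure_pmf.prob p {..<t} = t / (2 * N)"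
      by (simp_all add: prob)
    \<comment> \<open>For \<open>t\<close> in the window both \<open>t + 1\<close> and
      \<open>2 * N - t\<close> lie between \<open>N - h\<close> and \<open>N + h\<close>.\<close>
    have xy_\<rho>: "y \<le> \<rho> * x" "x \<le> \<rho> * y"
    proof -
      have "(2 * N - t) * (N - h) \<le> (N + h) * (t + 1)" "(t + 1) * (N - h) \<le> (N + h) * (2 * N - t)"
        by (rule mult_mono; use t hN in auto)+
      then have "real (2 * N - t) * real (N - h) \<le> real (N + h) * real (t + 1)"
          "real (t + 1) * real (N - h) \<le> real (N + h) * real (2 * N - t)"
        unfolding of_nat_mult[symmetric] of_nat_le_iff .
      then show "y \<le> \<rho> * x" "x \<le> \<rho> * y"
        using hN by (simp_all add: x_def y_def \<rho>_def divide_simps)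
    qed
    have "binomial_tail (N - 1) k (measure_pmf.prob p {t<..}) \<le> 2 * b * exp 5 * x ^ (N - 1)"
      unfolding b_def pr
    proof (rule tail)
      have "real (2 * N - Suc t) / (2 * N) \<le> y"
        unfolding y_def by (intro divide_right_mono) auto
      with xy_\<rho>(1) show "real (2 * N - Suc t) / (2 * N) \<le> \<rho> * x" by linarith
      show "1 - real (2 * N - Suc t) / (2 * N) \<le> x"
        using t' N by (simp add: x_def field_simps of_nat_diff)
    qed (use t' in auto)
    moreover have "binomial_tail (N - 1) k (measure_pmf.prob p {..<t}) \<le> 2 * b * exp 5 * y ^ (N - 1)"
      unfolding b_def pr
    proof (rule tail)
      have "t / (2 * N) \<le> x"
        unfolding x_def by (intro divide_right_mono) auto
      with xy_\<rho>(2) show "t / (2 * N) \<le> \<rho> * y" by linarith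
      show "1 - t / (2 * N) \<le> y"
        using t' N by (simp add: y_def field_simps of_nat_diff)
    qed (use t' in auto)
    ultimately have le: "pmf p t * (binomial_tail (N - 1) k (measure_pmf.prob p {t<..}) *
        binomial_tail (N - 1) k (measure_pmf.prob p {..<t})) \<le>
        1 / (2 * N) * ((2 * b * exp 5 * x ^ (N - 1)) * (2 * b * exp 5 * y ^ (N - 1)))"
      using \<open>0 < b\<close> t'
      by (intro mult_mono) (auto intro!: sum_nonneg mult_nonneg_nonneg simp: binomial_tail_def
        measure_pmf.prob_le_1 x_def y_def)
    have "(2 * b * exp 5 * x ^ (N - 1)) * (2 * b * exp 5 * y ^ (N - 1)) =
        4 * b\<^sup>2 * exp 10 * (x * y) ^ (N - 1)"
      by (simp add: power_mult_distrib power2_eq_square mult_ac flip: exp_add)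
    also have "\<dots> \<le> 4 * b\<^sup>2 * exp 10 * (4 * exp 1 / 4 ^ N)"
      by (rule mult_left_mono[OF xy]) simp
    also have "4 * b\<^sup>2 * exp 10 * (4 * exp 1 / 4 ^ N) = 16 * b\<^sup>2 * exp 11 / 4 ^ N"
      by (simp flip: exp_add)
    finally have "1 / (2 * N) * ((2 * b * exp 5 * x ^ (N - 1)) * (2 * b * exp 5 * y ^ (N - 1))) \<le>
        1 / (2 * N) * (16 * b\<^sup>2 * exp 11 / 4 ^ N)"
      by (rule mult_left_mono) simp
    with le show ?thesis
      by (rule order_trans)
  qed
  have q2: "(\<Sum>t\<in>{N - h..<N + h}. pmf p t * (binomial_tail (N - 1) k (measure_pmf.prob p {t<..}) *
      binomial_tail (N - 1) k (measure_pmf.prob p {..<t}))) \<le> 32 * ln N * b\<^sup>2 * exp 11 / (4 ^ N * N)"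
  proof -
    have "(\<Sum>t\<in>{N - h..<N + h}. pmf p t * (binomial_tail (N - 1) k (measure_pmf.prob p {t<..}) *
        binomial_tail (N - 1) k (measure_pmf.prob p {..<t}))) \<le>
        (\<Sum>t\<in>{N - h..<N + h}. 1 / (2 * N) * (16 * b\<^sup>2 * exp 11 / 4 ^ N))"
      by (intro sum_mono conflict)
    also have "\<dots> = 16 * h * b\<^sup>2 * exp 11 / (4 ^ N * N)"
      using hN by (simp add: of_nat_diff field_simps)
    also have "\<dots> \<le> 16 * (2 * ln N) * b\<^sup>2 * exp 11 / (4 ^ N * N)"
      using h(2) by (intro divide_right_mono mult_right_mono mult_left_mono) auto
    finally show ?thesis by simp
  qed

  have s: "1 \<le> sqrt (N * ln N)" "(sqrt (N * ln N))\<^sup>2 = N * ln N"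
  proof -
    have "1 * 1 \<le> N * ln N"
      using N lnN by (intro mult_mono) auto
    then show "1 \<le> sqrt (N * ln N)" by simp
  qed (use lnN in simp)
  have exp_ge: "2 ^ m \<le> exp (real m)" for m
    using power_mono[of 2 "exp 1 :: real" m] exp_ge_add_one_self[of 1] by (simp flip: exp_of_nat_mult)
  \<comment> \<open>The constant \<open>exp 12\<close> in \<open>\<delta>\<close> makes each of the
    two contributions at most 1/8: they are at most \<open>16 / exp 7\<close> and equal to
    \<open>128 / exp 13\<close>, respectively.\<close>
  have "2 * N * \<delta> * (8 * b * exp 5 / (2 ^ N * N)) = 16 * exp 5 / (exp 12 * sqrt (N * ln N))"
    using N \<open>0 < b\<close> unfolding \<delta> b_def[symmetric] by (simp add: field_simps)
  also have "\<dots> = 16 / (exp 7 * sqrt (N * ln N))"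
    using exp_add[of 5 "7 :: real"] by simp
  also have "\<dots> \<le> 16 / (2 ^ 7 * 1)"
    using s(1) exp_ge[of 7] by (intro divide_left_mono mult_mono) auto
  finally have small1: "2 * N * \<delta> * (8 * b * exp 5 / (2 ^ N * N)) \<le> 1 / 8"
    by simp
  have "\<delta>\<^sup>2 = 4 ^ N / (exp 24 * b\<^sup>2 * (N * ln N))"
    unfolding \<delta> b_def[symmetric]
    by (simp add: power_divide power_mult_distrib s(2) flip: exp_of_nat_mult power_mult)
      (simp add: power_mult mult.commute[of N])
  then have "4 * N\<^sup>2 * \<delta>\<^sup>2 * (32 * ln N * b\<^sup>2 * exp 11 / (4 ^ N * N)) = 128 * exp 11 / exp 24"
    using N lnN \<open>0 < b\<close> by (simp add: field_simps power2_eq_square)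
  also have "\<dots> = 128 / exp 13"
    using exp_add[of 11 "13 :: real"] by simp
  also have "\<dots> \<le> 128 / 2 ^ 13"
    using exp_ge[of 13] by (intro divide_left_mono) auto
  finally have "4 * N\<^sup>2 * \<delta>\<^sup>2 * (32 * ln N * b\<^sup>2 * exp 11 / (4 ^ N * N)) \<le> 1 / 8"
    by simp
  with small1 have "2 * N * \<delta> * (8 * b * exp 5 / (2 ^ N * N)) +
      4 * N\<^sup>2 * \<delta>\<^sup>2 * (32 * ln N * b\<^sup>2 * exp 11 / (4 ^ N * N)) \<le> 1 / 4"
    by linarith
  moreover have "0 \<le> \<delta>"
    using lnN by (simp add: \<delta>)
  moreover have "2 * k \<le> N" "0 < N"
    using k3 N by auto
  ultimately show ?thesis
    by (intro property_B_if_random_weights[OF assms(5,6) unif simple _ _ deg _ q1 q2])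
      (simp_all only: of_nat_mult of_nat_power of_nat_numeral not_False_eq_True)
qed

section \<open>Counting edges\<close>

text \<open>Adding the vertices of \<open>U\<close> one by one, a vertex added after
  \<open>j\<close> others shares at most \<open>j\<close> edges with them and so brings at least
  \<open>d - j\<close> new ones. Doubling avoids fractions; for \<open>card U = d\<close> the result
  is at least \<open>d\<^sup>2 / 2\<close> edges.\<close>

lemma card_edges_meeting_ge:
  assumes "finite E" "finite U"
    and pair: "\<And>u v. u \<in> U \<Longrightarrow> v \<in> U \<Longrightarrow> u \<noteq> v \<Longrightarrow> card {e\<in>E. u \<in> e \<and> v \<in> e} \<le> 1"
    and deg: "\<And>u. u \<in> U \<Longrightarrow> d \<le> card {e\<in>E. u \<in> e}"
  shows "2 * card U * d \<le> 2 * card {e\<in>E. e \<inter> U \<noteq> {}} + card U * card U"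
  using assms(2) pair deg
proof (induction U rule: finite_induct)
  case (insert u U)
  let ?M = "{e\<in>E. e \<inter> U \<noteq> {}}"
  have "card (\<Union>v\<in>U. {e\<in>E. u \<in> e \<and> v \<in> e}) \<le> (\<Sum>v\<in>U. card {e\<in>E. u \<in> e \<and> v \<in> e})"
    using insert.hyps by (intro card_UN_le)
  also have "\<dots> \<le> (\<Sum>v\<in>U. 1)"
    using insert.hyps insert.prems(1) by (intro sum_mono) auto
  finally have old: "card (\<Union>v\<in>U. {e\<in>E. u \<in> e \<and> v \<in> e}) \<le> card U"
    by simp
  have "{e\<in>E. u \<in> e} \<subseteq> ({e\<in>E. u \<in> e} - ?M) \<union> (\<Union>v\<in>U. {e\<in>E. u \<in> e \<and> v \<in> e})"
    by auto
  then have "card {e\<in>E. u \<in> e} \<le> card (({e\<in>E. u \<in> e} - ?M) \<union> (\<Union>v\<in>U. {e\<in>E. u \<in> e \<and> v \<in> e}))"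
    using assms(1) insert.hyps by (intro card_mono) auto
  also have "\<dots> \<le> card ({e\<in>E. u \<in> e} - ?M) + card (\<Union>v\<in>U. {e\<in>E. u \<in> e \<and> v \<in> e})"
    by (rule card_Un_le)
  finally have new: "d \<le> card ({e\<in>E. u \<in> e} - ?M) + card U"
    using old insert.prems(2)[of u] by simp
  have "{e\<in>E. e \<inter> insert u U \<noteq> {}} = ({e\<in>E. u \<in> e} - ?M) \<union> ?M"
    by auto
  moreover have "card (({e\<in>E. u \<in> e} - ?M) \<union> ?M) = card ({e\<in>E. u \<in> e} - ?M) + card ?M"
    using assms(1) by (intro card_Un_disjoint) auto
  ultimately have "card {e\<in>E. e \<inter> insert u U \<noteq> {}} = card ({e\<in>E. u \<in> e} - ?M) + card ?M"
    by simp
  with new insert.IH insert.prems insert.hyps show ?case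
    by (simp add: algebra_simps)
qed simp

text \<open>Delete from each edge a vertex of maximal degree. If a vertex then lies in \<open>d\<close> truncated edges,
  the \<open>d\<close> vertices deleted from these edges are distinct by simplicity, and each of them has
  degree at least \<open>d\<close>.\<close>

lemma card_edges_ge_if_not_property_B:
  fixes \<delta> :: real
  assumes "finite V" "E \<subseteq> Pow V" and unif: "\<And>e. e \<in> E \<Longrightarrow> card e = N + 1"
    and simple: "\<And>e f. e \<in> E \<Longrightarrow> f \<in> E \<Longrightarrow> e \<noteq> f \<Longrightarrow> card (e \<inter> f) \<le> 1"
    and not_B: "\<not> property_B k (V, E)" and "0 \<le> \<delta>"
    and small_degree: "\<And>E'. E' \<subseteq> Pow V \<Longrightarrow> (\<And>e. e \<in> E' \<Longrightarrow> card e = N) \<Longrightarrow>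
      (\<And>e f. e \<in> E' \<Longrightarrow> f \<in> E' \<Longrightarrow> e \<noteq> f \<Longrightarrow> card (e \<inter> f) \<le> 1) \<Longrightarrow>
      (\<And>v. v \<in> V \<Longrightarrow> card {e\<in>E'. v \<in> e} \<le> \<delta>) \<Longrightarrow> property_B k (V, E')"
  shows "\<delta>\<^sup>2 \<le> 2 * card E"
proof -
  have fin: "finite E" "\<And>e. e \<in> E \<Longrightarrow> finite e"
    using assms(1,2) by (auto intro: finite_subset)
  define deg where "deg v = card {e\<in>E. v \<in> e}" for v
  have "\<exists>u\<in>e. \<forall>v\<in>e. deg v \<le> deg u" if "e \<in> E" for e
  proof -
    have "e \<noteq> {}"
      using unif[OF that] by auto
    then have "Max (deg ` e) \<in> deg ` e"
      using fin(2)[OF that] by (intro Max_in) auto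
    then obtain u where "u \<in> e" "deg u = Max (deg ` e)"
      by auto
    then show ?thesis
      using fin(2)[OF that] by (intro bexI[of _ u]) auto
  qed
  then obtain t where t: "\<And>e. e \<in> E \<Longrightarrow> t e \<in> e" "\<And>e v. e \<in> E \<Longrightarrow> v \<in> e \<Longrightarrow> deg v \<le> deg (t e)"
    by metis
  have inter: "e = f" if "e \<in> E" "f \<in> E" "u \<noteq> v" "u \<in> e" "v \<in> e" "u \<in> f" "v \<in> f" for e f u v
  proof (rule ccontr)
    assume "e \<noteq> f"
    have "card {u, v} \<le> card (e \<inter> f)"
      using that fin by (intro card_mono) auto
    with simple[OF that(1,2) \<open>e \<noteq> f\<close>] \<open>u \<noteq> v\<close> show False by simp
  qed
  define E' where "E' = (\<lambda>e. e - {t e}) ` E"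
  have "\<not> property_B k (V, E')"
  proof
    assume "property_B k (V, E')"
    then obtain c :: "'a \<Rightarrow> bool" where "\<forall>e\<in>E'. \<forall>b. k \<le> card {v\<in>e. c v = b}"
      unfolding property_B_def by auto
    then have c: "k \<le> card {v\<in>e - {t e}. c v = b}" if "e \<in> E" for e b
      using that unfolding E'_def by blast
    have "k \<le> card {v\<in>e. c v = b}" if "e \<in> E" for e b
    proof (rule order_trans[OF c[OF that, of b]])
      show "card {v\<in>e - {t e}. c v = b} \<le> card {v\<in>e. c v = b}"
        using fin(2)[OF that] by (intro card_mono) auto
    qed
    then have "property_B k (V, E)"
      unfolding property_B_def prod.case by blast
    with not_B show False ..
  qed
  moreover have "card (e \<inter> f) \<le> 1" if ef: "e \<in> E'" "f \<in> E'" "e \<noteq> f" for e f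
  proof -
    obtain e0 f0 where e0: "e0 \<in> E" "e = e0 - {t e0}" and f0: "f0 \<in> E" "f = f0 - {t f0}"
      using ef by (auto simp: E'_def)
    then have "card (e \<inter> f) \<le> card (e0 \<inter> f0)"
      using fin by (intro card_mono) auto
    also have "\<dots> \<le> 1"
      using e0 f0 ef(3) by (intro simple) auto
    finally show ?thesis .
  qed
  moreover have "E' \<subseteq> Pow V" "\<And>e. e \<in> E' \<Longrightarrow> card e = N"
    using assms(2) unif t(1) fin(2) by (auto simp: E'_def)
  ultimately obtain v where v: "v \<in> V" "\<delta> < card {e\<in>E'. v \<in> e}"
    using small_degree[of E'] by (meson not_le)
  \<comment> \<open>Counting original edges makes it enough that truncation maps \<open>F\<close>
    onto the truncated edges at \<open>v\<close>.\<close>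
  define F where "F = {e\<in>E. v \<in> e - {t e}}"
  have "finite F"
    using fin(1) by (simp add: F_def)
  have "{e\<in>E'. v \<in> e} \<subseteq> (\<lambda>e. e - {t e}) ` F"
    by (auto simp: E'_def F_def)
  then have "card {e\<in>E'. v \<in> e} \<le> card F"
    using \<open>finite F\<close> by (intro surj_card_le)
  with v(2) have \<delta>F: "\<delta> \<le> card F"
    by linarith
  \<comment> \<open>Two edges of \<open>F\<close> with the same deleted vertex would share both it
    and \<open>v\<close>, which differ.\<close>
  have "inj_on t F"
  proof (rule inj_onI)
    fix e f assume "e \<in> F" "f \<in> F" "t e = t f"
    then show "e = f"
      using inter[of e f v "t e"] t(1)[of e] t(1)[of f] by (auto simp: F_def)
  qed
  then have U: "card (t ` F) = card F"
    by (rule card_image)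
  have "2 * card (t ` F) * card F \<le> 2 * card {e\<in>E. e \<inter> t ` F \<noteq> {}} + card (t ` F) * card (t ` F)"
  proof (rule card_edges_meeting_ge)
    fix u w :: 'a assume "u \<noteq> w"
    then have "\<forall>e f. e \<in> {e\<in>E. u \<in> e \<and> w \<in> e} \<longrightarrow> f \<in> {e\<in>E. u \<in> e \<and> w \<in> e} \<longrightarrow> e = f"
      using inter by blast
    then show "card {e\<in>E. u \<in> e \<and> w \<in> e} \<le> 1"
      using fin(1) by (simp add: card_le_Suc0_iff_eq)
  next
    fix u assume "u \<in> t ` F"
    then obtain e where e: "e \<in> E" "v \<in> e" "u = t e"
      by (auto simp: F_def)
    have "card F \<le> deg v"
      unfolding deg_def F_def using fin(1) by (intro card_mono) auto
    also have "\<dots> \<le> deg u"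
      using t(2)[OF e(1,2)] e(3) by simp
    finally show "card F \<le> card {e\<in>E. u \<in> e}"
      by (simp add: deg_def)
  qed (use fin(1) \<open>finite F\<close> in auto)
  moreover have "card {e\<in>E. e \<inter> t ` F \<noteq> {}} \<le> card E"
    using fin(1) by (intro card_mono) auto
  ultimately have "card F * card F \<le> 2 * card E"
    unfolding U by simp
  then have "(real (card F))\<^sup>2 \<le> 2 * card E"
    unfolding power2_eq_square by (simp flip: of_nat_mult)
  moreover have "\<delta>\<^sup>2 \<le> (real (card F))\<^sup>2"
    using \<delta>F \<open>0 \<le> \<delta>\<close> by (intro power_mono)
  ultimately show ?thesis
    by linarith
qed

section \<open>From the degree bound to the bound on \<open>m_star\<close>\<close>

theorem theorem5:
  fixes k n :: nat
  assumes "k \<ge> 2" and "n \<ge> 30"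
    and "real k \<le> sqrt (real n / ln (real n))"
  shows "ereal_of_enat (m_star k n) \<ge>
    ereal (25 / (18 * exp 52) *
      (2 ^ (2 * (n - 1)) /
        (real k * real (n - 1) * ln (real (n - 1)) * (real ((n - 2) choose (k - 1)))\<^sup>2)))"
proof -
  define N where "N = n - 1"
  have N: "29 \<le> N" "n = N + 1" "n - 2 = N - 1"
    using assms(2) by (auto simp: N_def)
  define b where "b = real ((N - 1) choose (k - 1))"
  define \<delta> where "\<delta> = 2 ^ N / (exp 12 * b * sqrt (N * ln N))"
  let ?X = "25 / (18 * exp 52) * (2 ^ (2 * N) / (real k * real N * ln N * b\<^sup>2))"
  have ln_pos: "0 < ln (real N)" "0 < ln (real n)"
    using N by auto
  have "(real k)\<^sup>2 \<le> real n / ln n"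
    using assms(3) ln_pos by (metis of_nat_0_le_iff power_mono real_sqrt_pow2 divide_nonneg_pos)
  then have kN: "(real k)\<^sup>2 * ln (real N + 1) \<le> real N + 1"
    using ln_pos N(2) by (simp add: field_simps)
  have "0 \<le> \<delta>"
    using ln_pos by (simp add: \<delta>_def b_def)
  \<comment> \<open>Apart from common factors this compares \<open>25 / (18 * exp 52 * k)\<close>
    with \<open>1 / (2 * exp 24)\<close>, for which \<open>k \<ge> 2\<close> and
    \<open>exp 28 \<ge> 29\<close> suffice.\<close>
  have X: "?X \<le> \<delta>\<^sup>2 / 2"
  proof -
    have "\<delta>\<^sup>2 = 1 / exp 24 * (2 ^ (2 * N) / (N * ln N * b\<^sup>2))"
      using ln_pos unfolding \<delta>_def
      by (simp add: power_divide power_mult_distrib mult_ac flip: exp_of_nat_mult power_mult)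
    moreover have "25 / (18 * exp 52 * real k) \<le> 1 / exp 24 / 2"
    proof -
      have "exp 24 * 2 * 25 \<le> exp 52 * (18 * 2 :: real)"
        using exp_add[of 24 "28 :: real"] exp_ge_add_one_self[of "28 :: real"] by simp
      also have "\<dots> \<le> exp 52 * (18 * real k)"
        using assms(1) by (intro mult_left_mono) auto
      finally show ?thesis
        using assms(1) by (simp add: field_simps)
    qed
    then have "25 / (18 * exp 52 * real k) * (2 ^ (2 * N) / (N * ln N * b\<^sup>2)) \<le>
        1 / exp 24 / 2 * (2 ^ (2 * N) / (N * ln N * b\<^sup>2))"
      using ln_pos by (intro mult_right_mono) auto
    ultimately show ?thesis
      by (simp add: mult_ac)
  qed
  have "?X \<le> card E" if H: "hypergraph (V, E)" "uniform n (V, E)" "simple (V, E)" "\<not> property_B k (V, E)"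
    for V :: "nat set" and E
  proof -
    have V: "finite V" "E \<subseteq> Pow V"
      using H(1) by (auto simp: hypergraph_def)
    have "\<delta>\<^sup>2 \<le> 2 * card E"
    proof (rule card_edges_ge_if_not_property_B[OF V _ _ H(4) \<open>0 \<le> \<delta>\<close>])
      show "card e = N + 1" if "e \<in> E" for e
        using H(2) that N(2) by (auto simp: uniform_def)
      show "card (e \<inter> f) \<le> 1" if "e \<in> E" "f \<in> E" "e \<noteq> f" for e f
        using H(3) that by (auto simp: simple_def)
    qed (rule property_B_if_small_degree[OF N(1) assms(1) kN \<delta>_def[unfolded b_def] V(1)], assumption+)
    with X show ?thesis by linarith
  qed
  \<comment> \<open>Edge numbers are integers, so the real bound may be rounded up and compared in
    \<open>enat\<close>. This also covers an empty set of hypergraphs, whose infimum is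
    infinite.\<close>
  then have "enat (nat \<lceil>?X\<rceil>) \<le> m_star k n"
    unfolding m_star_def by (intro Inf_greatest) (force simp: ceiling_le_iff nat_le_iff)
  then have "ereal_of_enat (enat (nat \<lceil>?X\<rceil>)) \<le> ereal_of_enat (m_star k n)"
    by (simp only: ereal_of_enat_le_iff)
  moreover have "ereal ?X \<le> ereal_of_enat (enat (nat \<lceil>?X\<rceil>))"
    by (simp add: real_nat_ceiling_ge)
  ultimately show ?thesis
    unfolding N(3) N_def[symmetric] b_def by (rule order_trans[rotated])
qed

end
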